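(* (i) Let $F\subseteq\mathbb{R}^p$ be the attractor of an iterated function system $f_1,\dots,f_m$ which satisfies the strong separation condition and is bi-Lipschitz, that is, for each $1\le i\le m$ there exist $0<\rho_i,\nu_i<1$ with $$\nu_i|x-y|\le|f_i(x)-f_i(y)|\le\rho_i|x-y|\quad\text{for all }x,y.$$ Then for small enough $\alpha>0$ (i.e. there is $\alpha_0>0$ such that for all $0<\alpha<\alpha_0$) we have $\underline{D}_*(\alpha,F)=D_*(\alpha,F)=0$. (ii) More specifically, if $F$ is a self-similar set satisfying the strong separation condition (that is, $F$ is the attractor of an iterated function system of contracting similarities satisfying the strong separation condition), then for every $0<\alpha<1$ we have $\underline{D}_*(\alpha,F)=D_*(\alpha,F)=0$.
   Context: An iterated function system is a finite family of contractions $f_1,\dots,f_m$ of a nonempty closed subset of $\mathbb{R}^p$ into itself; its attractor is the unique nonempty compact set $F$ with $F=\bigcup_{i=1}^m f_i(F)$. It satisfies the strong separation condition if the sets $f_1(F),\dots,f_m(F)$ are pairwise disjoint. For $F\subseteq\mathbb{R}^p$, $c>0$ and $0<\alpha\le1$, a function $f:F\to\mathbb{R}$ is $c$-Hölder-$\alpha$ if $|f(x)-f(y)|\le c|x-y|^\alpha$ for all $x,y\in F$. $C_1^\alpha(F)$ denotes the set of 1-Hölder-$\alpha$ functions on $F$, with the metric given by the supremum norm. For $f:F\to\mathbb{R}$ put $D^f(r,F)=\dim_H(f^{-1}(r))$ (Hausdorff dimension, with $\dim_H\emptyset=0$) and $$D_*^f(F)=\sup\{d\ge0:\lambda\{r\in\mathbb{R}: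 D^f(r,F)\ge d\}>0\},$$ where $\lambda$ is one-dimensional Lebesgue measure. Let $\mathfrak{G}_{1,\alpha}(F)$ be the collection of all dense $G_\delta$ subsets of $C_1^\alpha(F)$, and define $$D_*(\alpha,F)=\sup_{\mathcal{G}\in\mathfrak{G}_{1,\alpha}(F)}\ \inf\{D_*^f(F): f\in\mathcal{G}\},$$ $$\underline{D}_*(\alpha,F)=\inf\{D_*^f(F): f:F\to\mathbb{R}\text{ is locally non-constant and 1-Hölder-}\alpha\},$$ where the infimum of the empty set is $0$ and $f$ is locally non-constant if $f$ is non-constant on $U\cap F$ whenever $U$ is a neighborhood of an accumulation point of $F$. *)

theory Defs
  imports "HOL-Analysis.Analysis"
begin

section \<open>Hausdorff dimension\<close>

text \<open>
  The \<open>s\<close>-th power of the diameter of a set, with the usual conventions that the empty set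
  contributes \<open>0\<close> and that \<open>0\<^sup>0 = 1\<close> for nonempty sets (whereas \<^term>\<open>0 powr 0 = (0::real)\<close>).
\<close>

definition diam_pow :: "real \<Rightarrow> 'a::metric_space set \<Rightarrow> ennreal" where
  "diam_pow s U = (if U = {} then 0 else if s = 0 then 1 else ennreal (diameter U powr s))"

text \<open>
  Boundedness of the covering sets has to be required separately, since \<^const>\<open>diameter\<close> is
  real-valued and carries no information for unbounded sets.
\<close>

definition delta_covers :: "real \<Rightarrow> 'a::metric_space set \<Rightarrow> (nat \<Rightarrow> 'a set) set" where
  "delta_covers \<delta> A =
     {U. A \<subseteq> (\<Union>n. U n) \<and> (\<forall>n. bounded (U n) \<and> diameter (U n) \<le> \<delta>)}"

definition hausdorff_content :: "real \<Rightarrow> real \<Rightarrow> 'a::metric_space set \<Rightarrow> ennreal" where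
  "hausdorff_content s \<delta> A = (INF U \<in> delta_covers \<delta> A. \<Sum>n. diam_pow s (U n))"

definition hausdorff_measure :: "real \<Rightarrow> 'a::metric_space set \<Rightarrow> ennreal" where
  "hausdorff_measure s A = (SUP \<delta> \<in> {0<..}. hausdorff_content s \<delta> A)"

definition hausdorff_dim :: "'a::metric_space set \<Rightarrow> ennreal" where
  "hausdorff_dim A = Inf {ennreal s | s. 0 \<le> s \<and> hausdorff_measure s A = 0}"


section \<open>Iterated function systems\<close>

definition ifs :: "'a::metric_space set \<Rightarrow> nat \<Rightarrow> (nat \<Rightarrow> 'a \<Rightarrow> 'a) \<Rightarrow> bool" where
  "ifs X m f \<longleftrightarrow>
     closed X \<and> X \<noteq> {} \<and> 1 \<le> m \<and>
     (\<forall>i\<in>{1..m}. f i ` X \<subseteq> X \<and> (\<exists>c<1. c-lipschitz_on X (f i)))"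

text \<open>
  By Hutchinson's theorem an iterated function system on a closed subset of a Euclidean space has
  exactly one attractor, so the defining equation determines the set.
\<close>

definition attractor_of ::
    "'a::metric_space set \<Rightarrow> nat \<Rightarrow> (nat \<Rightarrow> 'a \<Rightarrow> 'a) \<Rightarrow> 'a set \<Rightarrow> bool" where
  "attractor_of X m f F \<longleftrightarrow>
     F \<subseteq> X \<and> F \<noteq> {} \<and> compact F \<and> F = (\<Union>i\<in>{1..m}. f i ` F)"

definition strong_separation :: "nat \<Rightarrow> (nat \<Rightarrow> 'a \<Rightarrow> 'a) \<Rightarrow> 'a set \<Rightarrow> bool" where
  "strong_separation m f F \<longleftrightarrow> disjoint_family_on (\<lambda>i. f i ` F) {1..m}"

definition bi_lipschitz_ifs ::
    "'a::metric_space set \<Rightarrow> nat \<Rightarrow> (nat \<Rightarrow> 'a \<Rightarrow> 'a) \<Rightarrow> bool" where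
  "bi_lipschitz_ifs X m f \<longleftrightarrow>
     (\<forall>i\<in>{1..m}. \<exists>\<rho> \<nu>. 0 < \<rho> \<and> \<rho> < 1 \<and> 0 < \<nu> \<and> \<nu> < 1 \<and>
        (\<forall>x\<in>X. \<forall>y\<in>X. \<nu> * dist x y \<le> dist (f i x) (f i y) \<and>
                          dist (f i x) (f i y) \<le> \<rho> * dist x y))"

definition similarity_ifs ::
    "'a::metric_space set \<Rightarrow> nat \<Rightarrow> (nat \<Rightarrow> 'a \<Rightarrow> 'a) \<Rightarrow> bool" where
  "similarity_ifs X m f \<longleftrightarrow>
     (\<forall>i\<in>{1..m}. \<exists>\<rho>. 0 < \<rho> \<and> \<rho> < 1 \<and>
        (\<forall>x\<in>X. \<forall>y\<in>X. dist (f i x) (f i y) = \<rho> * dist x y))"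


section \<open>Hoelder functions\<close>

definition hoelder_on ::
    "real \<Rightarrow> real \<Rightarrow> 'a::metric_space set \<Rightarrow> ('a \<Rightarrow> real) \<Rightarrow> bool" where
  "hoelder_on c \<alpha> F f \<longleftrightarrow> (\<forall>x\<in>F. \<forall>y\<in>F. \<bar>f x - f y\<bar> \<le> c * dist x y powr \<alpha>)"

text \<open>
  Functions \<open>F \<rightarrow> \<real>\<close> are represented by total functions that are
  \<^const>\<open>undefined\<close> outside \<open>F\<close>.
\<close>

definition hoelder_functions ::
    "real \<Rightarrow> real \<Rightarrow> 'a::metric_space set \<Rightarrow> ('a \<Rightarrow> real) set" where
  "hoelder_functions c \<alpha> F = {f \<in> extensional F. hoelder_on c \<alpha> F f}"

text \<open>
  \<^const>\<open>funspace\<close> is the space of bounded functions with the supremum metric.  For bounded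
  \<open>F\<close> and \<open>\<alpha> > 0\<close> every Hoelder function is bounded, so that the underlying set of the following
  metric space is all of \<^term>\<open>hoelder_functions 1 \<alpha> F\<close>.
\<close>

definition hoelder_space :: "real \<Rightarrow> 'a::metric_space set \<Rightarrow> ('a \<Rightarrow> real) metric" where
  "hoelder_space \<alpha> F = submetric (funspace F euclidean_metric) (hoelder_functions 1 \<alpha> F)"

definition dense_gdeltas :: "real \<Rightarrow> 'a::metric_space set \<Rightarrow> ('a \<Rightarrow> real) set set" where
  "dense_gdeltas \<alpha> F =
     {G. gdelta_in (mtopology_of (hoelder_space \<alpha> F)) G \<and>
         mtopology_of (hoelder_space \<alpha> F) closure_of G = mspace (hoelder_space \<alpha> F)}"

definition locally_nonconstant :: "'a::metric_space set \<Rightarrow> ('a \<Rightarrow> real) \<Rightarrow> bool" where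
  "locally_nonconstant F f \<longleftrightarrow>
     (\<forall>x U. x islimpt F \<and> x \<in> interior U \<longrightarrow> \<not> f constant_on (U \<inter> F))"


section \<open>Dimension of level sets\<close>

definition level_dim :: "('a::metric_space \<Rightarrow> real) \<Rightarrow> real \<Rightarrow> 'a set \<Rightarrow> ennreal" where
  "level_dim f r F = hausdorff_dim {x\<in>F. f x = r}"

text \<open>
  The outer measure agrees with Lebesgue measure on measurable sets; unlike \<^const>\<open>emeasure\<close>
  it does not assign the value \<open>0\<close> to nonmeasurable sets.
\<close>

definition D_star_fun :: "('a::metric_space \<Rightarrow> real) \<Rightarrow> 'a set \<Rightarrow> ennreal" where
  "D_star_fun f F =
     Sup {ennreal d | d. 0 \<le> d \<and> outer_measure_of lebesgue {r. level_dim f r F \<ge> ennreal d} > 0}"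

definition D_star :: "real \<Rightarrow> 'a::metric_space set \<Rightarrow> ennreal" where
  "D_star \<alpha> F = (SUP G \<in> dense_gdeltas \<alpha> F. INF f \<in> G. D_star_fun f F)"

text \<open>The infimum of the empty set is \<open>0\<close> by convention here, whereas it is \<open>\<infinity>\<close> in \<^typ>\<open>ennreal\<close>.\<close>

definition D_star_lower :: "real \<Rightarrow> 'a::metric_space set \<Rightarrow> ennreal" where
  "D_star_lower \<alpha> F =
     (let L = {f \<in> hoelder_functions 1 \<alpha> F. locally_nonconstant F f}
      in if L = {} then 0 else INF f \<in> L. D_star_fun f F)"

end

theory Submission
  imports Defs
begin

text \<open>
  Both quantities vanish because 1-Hoelder-\<open>\<alpha>\<close> functions with finite range are dense. If a function has
  a Lebesgue null range, almost all of its level sets are empty, so its \<open>D\<^sub>*\<close> is zero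
  (\<open>D_star_fun_eq_0_if_negligible_image\<close>). The set of functions whose range has measure less than \<open>\<epsilon>\<close>
  is open, because the range of a continuous function on a compact set is compact, and it contains
  all functions with finite range. So, once the latter are dense, Baire's theorem in the complete
  metric space of 1-Hoelder-\<open>\<alpha>\<close> functions yields a function with null range in every dense \<open>G\<^sub>\<delta>\<close>
  set (\<open>generic_negligible_image\<close>). This gives \<open>D\<^sub>* = 0\<close>. Applied to the dense \<open>G\<^sub>\<delta>\<close> set of locally
  non-constant functions it gives a locally non-constant function with null range, and the lower
  quantity is zero as well.

  The density of functions with finite range is where the geometry enters. Strong separation makes \<open>F\<close>
  a disjoint union of small copies of itself, and sending each copy of generation \<open>n\<close> to one of its
  points defines a map \<open>p\<close> with finite range. If \<open>\<rho>\<^sub>i \<le> \<nu>\<^sub>i powr \<beta>\<close> for all \<open>i\<close>, these maps are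
  \<open>\<beta>\<close>-Hoelder with a constant that does not depend on \<open>n\<close>: two points that first separate within a copy
  are at a distance which controls the diameter of that copy
  (\<open>attractor_has_hoelder_discretisations\<close>). Given a 1-Hoelder-\<open>\<alpha>\<close> function, shrink it a little, replace it
  by a nearby Lipschitz function with the same Hoelder constant (\<open>lipschitz_approximation\<close>), and compose
  with \<open>p\<close>. For \<open>\<alpha> < \<beta>\<close> the composition is again 1-Hoelder-\<open>\<alpha>\<close> when \<open>n\<close> is large
  (\<open>finite_valued_dense\<close>).

  For similarities \<open>\<rho>\<^sub>i = \<nu>\<^sub>i\<close>, so \<open>\<beta> = 1\<close> and all \<open>\<alpha> < 1\<close> are covered. In the bi-Lipschitz case some
  \<open>\<beta> > 0\<close> works for the finitely many maps, and \<open>\<alpha>\<^sub>0 = \<beta>\<close>.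
\<close>

section \<open>A concave modulus of continuity and Lipschitz approximation\<close>

text \<open>
  The function \<open>t powr \<alpha>\<close> with its steep part below \<open>\<delta>\<close> replaced by a line through the origin.
  For \<open>\<alpha> \<le> 1\<close> the form \<open>t\<close> times a nonincreasing factor makes subadditivity immediate.
\<close>

definition modulus :: "real \<Rightarrow> real \<Rightarrow> real \<Rightarrow> real" where
  "modulus \<alpha> \<delta> t = t * max t \<delta> powr (\<alpha> - 1)"

lemma modulus_nonneg: "0 \<le> t \<Longrightarrow> 0 \<le> modulus \<alpha> \<delta> t"
  by (simp add: modulus_def)

lemma modulus_eq_powr: "0 < \<delta> \<Longrightarrow> \<delta> \<le> t \<Longrightarrow> modulus \<alpha> \<delta> t = t powr \<alpha>"
  by (simp add: modulus_def max_def powr_diff)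

lemma modulus_le_linear:
  assumes "0 < \<delta>" "\<alpha> \<le> 1" "0 \<le> t"
  shows "modulus \<alpha> \<delta> t \<le> \<delta> powr (\<alpha> - 1) * t"
  unfolding modulus_def using assms
  by (subst mult.commute) (intro mult_right_mono powr_mono2', auto)

lemma modulus_le_powr:
  assumes "\<alpha> \<le> 1" "0 \<le> t"
  shows "modulus \<alpha> \<delta> t \<le> t powr \<alpha>"
proof (cases "t = 0")
  case False
  then have "t * max t \<delta> powr (\<alpha> - 1) \<le> t * t powr (\<alpha> - 1)"
    using assms by (intro mult_left_mono powr_mono2') auto
  also have "\<dots> = t powr \<alpha>"
    using False assms by (simp add: powr_diff)
  finally show ?thesis by (simp add: modulus_def)
qed (simp add: modulus_def)

lemma modulus_mono:
  assumes "0 < \<delta>" "0 \<le> \<alpha>" "0 \<le> s" "s \<le> t"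
  shows "modulus \<alpha> \<delta> s \<le> modulus \<alpha> \<delta> t"
proof -
  have lin: "modulus \<alpha> \<delta> s \<le> modulus \<alpha> \<delta> t" if "s \<le> t" "t \<le> \<delta>" for s t
    using that by (simp add: modulus_def max_def mult_right_mono)
  have pow: "modulus \<alpha> \<delta> s \<le> modulus \<alpha> \<delta> t" if "\<delta> \<le> s" "s \<le> t" for s t
    using that assms by (simp add: modulus_eq_powr powr_mono2)
  show ?thesis
    using lin[of s t] pow[of s t] lin[of s \<delta>] pow[of \<delta> t] assms by linarith
qed

text \<open>
  The factor of \<open>s + t\<close> in the definition is at most that of \<open>s\<close> and at most that of \<open>t\<close>.
\<close>

lemma modulus_subadditive:
  assumes "0 < \<delta>" "\<alpha> \<le> 1" "0 \<le> s" "0 \<le> t"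
  shows "modulus \<alpha> \<delta> (s + t) \<le> modulus \<alpha> \<delta> s + modulus \<alpha> \<delta> t"
proof -
  have "max (s + t) \<delta> powr (\<alpha> - 1) \<le> max s \<delta> powr (\<alpha> - 1)"
    "max (s + t) \<delta> powr (\<alpha> - 1) \<le> max t \<delta> powr (\<alpha> - 1)"
    using assms by (auto intro!: powr_mono2')
  with assms(3,4) show ?thesis
    unfolding modulus_def distrib_right by (intro add_mono mult_left_mono)
qed

lemma modulus_dist_triangle:
  fixes x y z :: "'a::metric_space"
  assumes "0 < \<delta>" "0 \<le> \<alpha>" "\<alpha> \<le> 1"
  shows "modulus \<alpha> \<delta> (dist x z) \<le> modulus \<alpha> \<delta> (dist x y) + modulus \<alpha> \<delta> (dist y z)"
  using modulus_mono[of \<delta> \<alpha> "dist x z" "dist x y + dist y z"]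
    modulus_subadditive[of \<delta> \<alpha> "dist x y" "dist y z"] assms dist_triangle[of x z y]
  by fastforce

text \<open>
  Mollification makes no sense on an arbitrary set; instead \<open>h\<close> is the infimal convolution of \<open>g\<close>
  with a subadditive modulus that lies below both \<open>c * t powr \<alpha>\<close> and a linear function. Any such
  infimum inherits the modulus.
\<close>

lemma lipschitz_approximation:
  fixes F :: "'a::metric_space set"
  assumes F: "F \<noteq> {}" and \<alpha>: "0 < \<alpha>" "\<alpha> \<le> 1" and c: "0 \<le> c" "c \<le> 1" and \<epsilon>: "0 < \<epsilon>"
    and bdd: "bounded (g ` F)" and g: "hoelder_on c \<alpha> F g"
  shows "\<exists>h M. 0 \<le> M \<and> hoelder_on c \<alpha> F h \<and> hoelder_on M 1 F h \<and> (\<forall>x\<in>F. \<bar>g x - h x\<bar> \<le> \<epsilon>)"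
proof -
  \<comment> \<open>Below the scale \<open>\<delta>\<close> the Hoelder bound allows an oscillation of at most \<open>\<delta> powr \<alpha> = \<epsilon>\<close>,
    so replacing the power by a linear function there costs at most \<open>\<epsilon>\<close>.\<close>
  define \<delta> where "\<delta> = \<epsilon> powr (1 / \<alpha>)"
  have \<delta>: "0 < \<delta>" "\<delta> powr \<alpha> = \<epsilon>"
    using \<alpha> \<epsilon> by (auto simp: \<delta>_def powr_powr)
  define w where "w x y = c * modulus \<alpha> \<delta> (dist x y)" for x y :: 'a
  have w_nonneg: "0 \<le> w x y" for x y
    using c by (simp add: w_def modulus_nonneg)
  have w_triangle: "w x z \<le> w x y + w y z" for x y z
    using mult_left_mono[OF modulus_dist_triangle[of \<delta> \<alpha> x z y] c(1)] \<delta> \<alpha>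
    by (simp add: w_def distrib_left)
  have w_comm: "w x y = w y x" for x y
    by (simp add: w_def dist_commute)
  \<comment> \<open>McShane's extension formula with \<open>w\<close> in place of a multiple of the distance.\<close>
  define h where "h x = (INF y\<in>F. g y + w x y)" for x
  obtain B where B: "\<And>x. x \<in> F \<Longrightarrow> \<bar>g x\<bar> \<le> B"
    using bdd by (auto simp: bounded_iff)
  have below: "bdd_below ((\<lambda>y. g y + w x y) ` F)" for x
  proof (rule bdd_belowI2)
    fix y assume "y \<in> F"
    then show "- B \<le> g y + w x y"
      using B[of y] w_nonneg[of x y] by linarith
  qed
  have h_le: "h x \<le> g y + w x y" if "y \<in> F" for x y
    unfolding h_def by (intro cINF_lower below that)
  have h_ge: "u \<le> h x" if "\<And>y. y \<in> F \<Longrightarrow> u \<le> g y + w x y" for u x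
    unfolding h_def using that F by (intro cINF_greatest)
  have "h x \<le> h z + w x z" for x z
  proof -
    have "h x - w x z \<le> h z"
    proof (rule h_ge)
      fix y assume "y \<in> F"
      then show "h x - w x z \<le> g y + w z y"
        using h_le[of y x] w_triangle[of x y z] by linarith
    qed
    then show ?thesis by simp
  qed
  from this[of x z for x z] this[of z x for x z] have h_w: "\<bar>h x - h z\<bar> \<le> w x z" for x z
    using w_comm[of x z] by (smt (verit))
  have "hoelder_on c \<alpha> F h"
    unfolding hoelder_on_def
  proof (intro ballI)
    fix x y
    have "w x y \<le> c * dist x y powr \<alpha>"
      unfolding w_def using c \<alpha> by (intro mult_left_mono modulus_le_powr) auto
    with h_w show "\<bar>h x - h y\<bar> \<le> c * dist x y powr \<alpha>" by (rule order_trans)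
  qed
  moreover have "hoelder_on (c * \<delta> powr (\<alpha> - 1)) 1 F h"
    unfolding hoelder_on_def
  proof (intro ballI)
    fix x y
    have "w x y \<le> c * (\<delta> powr (\<alpha> - 1) * dist x y)"
      unfolding w_def using c \<alpha> \<delta> by (intro mult_left_mono modulus_le_linear) auto
    with h_w[of x y] show "\<bar>h x - h y\<bar> \<le> c * \<delta> powr (\<alpha> - 1) * dist x y powr 1"
      by (simp add: mult.assoc)
  qed
  moreover have "\<bar>g x - h x\<bar> \<le> \<epsilon>" if x: "x \<in> F" for x
  proof -
    have "h x \<le> g x"
      using h_le[OF x, of x] by (simp add: w_def modulus_def)
    moreover have "g x - \<epsilon> \<le> h x"
    proof (rule h_ge)
      fix y assume y: "y \<in> F"
      have *: "g x - g y \<le> c * dist x y powr \<alpha>"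
        using g x y by (force simp: hoelder_on_def)
      show "g x - \<epsilon> \<le> g y + w x y"
      proof (cases "\<delta> \<le> dist x y")
        case True
        then have "w x y = c * dist x y powr \<alpha>"
          using \<delta> by (simp add: w_def modulus_eq_powr)
        with * \<epsilon> show ?thesis by linarith
      next
        case False
        then have "c * dist x y powr \<alpha> \<le> 1 * \<delta> powr \<alpha>"
          using c \<alpha> by (intro mult_mono powr_mono2) auto
        with * \<delta>(2) w_nonneg[of x y] show ?thesis by linarith
      qed
    qed
    ultimately show ?thesis by linarith
  qed
  moreover have "0 \<le> c * \<delta> powr (\<alpha> - 1)"
    using c by simp
  ultimately show ?thesis by blast
qed

section \<open>The complete metric space of Hoelder functions\<close>

lemma bounded_hoelder_image:
  fixes F :: "'a::metric_space set"
  assumes "compact F" "0 \<le> \<alpha>" "h \<in> hoelder_functions c \<alpha> F" "0 \<le> c"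
  shows "bounded (h ` F)"
proof (cases "F = {}")
  case False
  then obtain a where a: "a \<in> F" by auto
  obtain D where D: "\<And>x y. x \<in> F \<Longrightarrow> y \<in> F \<Longrightarrow> dist x y \<le> D"
    using compact_imp_bounded[OF assms(1)] by (metis bounded_two_points)
  have "dist (h a) (h x) \<le> c * D powr \<alpha>" if "x \<in> F" for x
  proof -
    have "dist (h a) (h x) \<le> c * dist a x powr \<alpha>"
      using assms(3) a that by (auto simp: hoelder_functions_def hoelder_on_def dist_real_def)
    also have "\<dots> \<le> c * D powr \<alpha>"
      using D[OF a that] assms by (intro mult_left_mono powr_mono2) auto
    finally show ?thesis .
  qed
  then show ?thesis
    unfolding bounded_def by blast
qed auto

lemma continuous_on_hoelder:
  fixes F :: "'a::metric_space set"
  assumes "0 < \<alpha>" "h \<in> hoelder_functions c \<alpha> F"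
  shows "continuous_on F h"
  unfolding continuous_on
proof
  fix x assume x: "x \<in> F"
  have "((\<lambda>y. c * dist y x powr \<alpha>) \<longlongrightarrow> c * dist x x powr \<alpha>) (at x within F)"
    using assms(1) by (auto intro!: tendsto_eq_intros tendsto_powr2)
  then have "((\<lambda>y. c * dist y x powr \<alpha>) \<longlongrightarrow> 0) (at x within F)"
    using assms(1) by simp
  moreover have "\<forall>\<^sub>F y in at x within F. dist (h y) (h x) \<le> c * dist y x powr \<alpha>"
    using assms(2) x
    by (auto simp: eventually_at_filter hoelder_functions_def hoelder_on_def dist_real_def)
  ultimately show "(h \<longlongrightarrow> h x) (at x within F)"
    by (intro metric_tendsto_imp_tendsto[of "\<lambda>y. c * dist y x powr \<alpha>" 0 _ h "h x"])
       (auto elim: eventually_mono)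
qed

lemma mspace_hoelder_space:
  fixes F :: "'a::metric_space set"
  assumes "compact F" "0 \<le> \<alpha>"
  shows "mspace (hoelder_space \<alpha> F) = hoelder_functions 1 \<alpha> F"
proof -
  have "h \<in> mspace (funspace F euclidean_metric)" if "h \<in> hoelder_functions 1 \<alpha> F" for h
    using bounded_hoelder_image[OF assms that] that
    by (simp add: Met_TC.fspace_def hoelder_functions_def)
  then show ?thesis
    unfolding hoelder_space_def mspace_submetric by blast
qed

text \<open>
  Turns the supremum metric into the pointwise bounds on which the criteria for open and for dense
  sets below rest.
\<close>

lemma mdist_hoelder_space_le:
  fixes F :: "'a::metric_space set"
  assumes "compact F" "0 \<le> \<alpha>" "F \<noteq> {}"
    and "g \<in> hoelder_functions 1 \<alpha> F" "h \<in> hoelder_functions 1 \<alpha> F"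
  shows "mdist (hoelder_space \<alpha> F) g h \<le> a \<longleftrightarrow> (\<forall>x\<in>F. \<bar>g x - h x\<bar> \<le> a)"
proof -
  have "g \<in> mspace (funspace F euclidean_metric)" "h \<in> mspace (funspace F euclidean_metric)"
    using mspace_hoelder_space[OF assms(1,2)] assms(4,5)
    by (auto simp: hoelder_space_def simp del: mspace_funspace)
  then show ?thesis
    using funspace_mdist_le[of g F euclidean_metric h a] assms(3)
    by (simp add: hoelder_space_def dist_real_def del: mspace_funspace mdist_funspace)
qed

text \<open>
  The Hoelder condition survives pointwise limits, so the space is closed in the complete space of
  bounded functions.
\<close>

lemma mcomplete_hoelder_space:
  fixes F :: "'a::metric_space set"
  assumes "compact F" "0 \<le> \<alpha>" "F \<noteq> {}"
  shows "mcomplete_of (hoelder_space \<alpha> F)"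
proof -
  let ?M = "funspace F (euclidean_metric :: real metric)" and ?H = "hoelder_functions 1 \<alpha> F"
  interpret M: Metric_space "mspace ?M" "mdist ?M"
    by (rule Metric_space_mspace_mdist)
  have sub: "?H \<subseteq> mspace ?M"
    using mspace_hoelder_space[OF assms(1,2)] by (auto simp: hoelder_space_def)
  interpret S: Submetric "mspace ?M" "mdist ?M" ?H
    using sub by unfold_locales
  have "mcomplete_of ?M"
    using Met_TC.mcomplete_funspace[where ?'a = real and S = F]
    by (simp add: euclidean_metric_def Met_TC.Self_def complete_UNIV)
  then have M: "M.mcomplete"
    by (simp add: mcomplete_of_def)
  have "l \<in> ?H" if \<sigma>: "range \<sigma> \<subseteq> ?H" and lim: "limitin M.mtopology \<sigma> l sequentially" for \<sigma> l
  proof -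
    have l: "l \<in> mspace ?M" and small: "\<And>\<epsilon>. \<epsilon> > 0 \<Longrightarrow> \<exists>N. \<forall>n\<ge>N. mdist ?M (\<sigma> n) l < \<epsilon>"
      using lim unfolding M.limit_metric_sequentially by blast+
    have conv: "(\<lambda>n. \<sigma> n x) \<longlonglongrightarrow> l x" if "x \<in> F" for x
      unfolding lim_sequentially
    proof (intro strip)
      fix \<epsilon> :: real assume "\<epsilon> > 0"
      then obtain N where N: "\<And>n. n \<ge> N \<Longrightarrow> mdist ?M (\<sigma> n) l < \<epsilon>"
        using small by blast
      have "dist (\<sigma> n x) (l x) \<le> mdist ?M (\<sigma> n) l" for n
      proof -
        have "\<sigma> n \<in> mspace ?M" using \<sigma> sub by blast
        from funspace_mdist_le[OF this l assms(3), of "mdist ?M (\<sigma> n) l"] that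
        show ?thesis by (simp del: mspace_funspace mdist_funspace)
      qed
      then show "\<exists>N. \<forall>n\<ge>N. dist (\<sigma> n x) (l x) < \<epsilon>"
        using N by (meson le_less_trans)
    qed
    have "\<bar>l x - l y\<bar> \<le> 1 * dist x y powr \<alpha>" if "x \<in> F" "y \<in> F" for x y
    proof (rule LIMSEQ_le_const2)
      show "(\<lambda>n. \<bar>\<sigma> n x - \<sigma> n y\<bar>) \<longlonglongrightarrow> \<bar>l x - l y\<bar>"
        by (intro tendsto_intros conv that)
      show "\<exists>N. \<forall>n\<ge>N. \<bar>\<sigma> n x - \<sigma> n y\<bar> \<le> 1 * dist x y powr \<alpha>"
        using \<sigma> that by (force simp: hoelder_functions_def hoelder_on_def)
    qed
    moreover have "l \<in> extensional F"
      using l by (rule funspace_imp_extensional)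
    ultimately show ?thesis
      by (auto simp: hoelder_functions_def hoelder_on_def)
  qed
  then have "S.sub.mcomplete"
    using S.sequentially_closedin_mcomplete_imp_mcomplete[OF M] by blast
  moreover have "mspace (hoelder_space \<alpha> F) = ?H" "mdist (hoelder_space \<alpha> F) = mdist ?M"
    using mspace_hoelder_space[OF assms(1,2)] by (simp_all add: hoelder_space_def)
  ultimately show ?thesis
    by (simp add: mcomplete_of_def del: mspace_funspace mdist_funspace)
qed

lemma openin_hoelder_spaceI:
  fixes F :: "'a::metric_space set"
  assumes "compact F" "0 \<le> \<alpha>" "F \<noteq> {}" "U \<subseteq> hoelder_functions 1 \<alpha> F"
    and "\<And>g. g \<in> U \<Longrightarrow> \<exists>r>0. \<forall>h\<in>hoelder_functions 1 \<alpha> F. (\<forall>x\<in>F. \<bar>g x - h x\<bar> < r) \<longrightarrow> h \<in> U"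
  shows "openin (mtopology_of (hoelder_space \<alpha> F)) U"
proof -
  let ?H = "hoelder_space \<alpha> F"
  interpret H: Metric_space "mspace ?H" "mdist ?H"
    by (rule Metric_space_mspace_mdist)
  note H = mspace_hoelder_space[OF assms(1,2)]
  show ?thesis
    unfolding mtopology_of_def H.openin_mtopology
  proof (intro conjI allI impI)
    show "U \<subseteq> mspace ?H" using assms(4) H by simp
    fix g assume g: "g \<in> U"
    then obtain r where r: "r > 0"
      and rU: "\<forall>h\<in>hoelder_functions 1 \<alpha> F. (\<forall>x\<in>F. \<bar>g x - h x\<bar> < r) \<longrightarrow> h \<in> U"
      using assms(5)[OF g] by (elim exE conjE)
    have "h \<in> U" if h: "h \<in> H.mball g r" for h
    proof -
      have h: "h \<in> mspace ?H" "mdist ?H g h < r"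
        using h unfolding H.in_mball by blast+
      have hH: "h \<in> hoelder_functions 1 \<alpha> F" and gH: "g \<in> hoelder_functions 1 \<alpha> F"
        using h(1) g assms(4) unfolding H by fast+
      have "\<forall>x\<in>F. \<bar>g x - h x\<bar> \<le> mdist ?H g h"
        using mdist_hoelder_space_le[OF assms(1-3) gH hH, of "mdist ?H g h"] by (simp only: order_refl)
      with h(2) have "\<forall>x\<in>F. \<bar>g x - h x\<bar> < r"
        by (meson le_less_trans)
      with hH rU show ?thesis by (meson bspec mp)
    qed
    with r show "\<exists>r>0. H.mball g r \<subseteq> U" by blast
  qed
qed

lemma dense_in_hoelder_spaceI:
  fixes F :: "'a::metric_space set"
  assumes "compact F" "0 \<le> \<alpha>" "F \<noteq> {}"
    and "\<And>g \<epsilon>. g \<in> hoelder_functions 1 \<alpha> F \<Longrightarrow> \<epsilon> > 0 \<Longrightarrow>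
           \<exists>h\<in>U \<inter> hoelder_functions 1 \<alpha> F. \<forall>x\<in>F. \<bar>g x - h x\<bar> \<le> \<epsilon>"
  shows "mtopology_of (hoelder_space \<alpha> F) closure_of U = mspace (hoelder_space \<alpha> F)"
proof -
  let ?H = "hoelder_space \<alpha> F"
  interpret H: Metric_space "mspace ?H" "mdist ?H"
    by (rule Metric_space_mspace_mdist)
  note H = mspace_hoelder_space[OF assms(1,2)]
  have "\<exists>h\<in>U. h \<in> H.mcball g r" if gr: "g \<in> mspace ?H" "r > 0" for g r
  proof -
    have g: "g \<in> hoelder_functions 1 \<alpha> F" using gr(1) H by (simp only:)
    obtain h where h: "h \<in> U" "h \<in> hoelder_functions 1 \<alpha> F" "\<forall>x\<in>F. \<bar>g x - h x\<bar> \<le> r"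
      using assms(4)[OF g gr(2)] by (elim bexE IntE)
    then have "mdist ?H g h \<le> r"
      using mdist_hoelder_space_le[OF assms(1-3) g, of h r] by (simp only:)
    then have "h \<in> H.mcball g r"
      unfolding H.in_mcball unfolding H using g h(2) by (intro conjI)
    with h(1) show ?thesis by (intro bexI)
  qed
  then show ?thesis
    unfolding mtopology_of_def H.metric_closure_of_alt by blast
qed

text \<open>
  Only the existence of a point in the intersection matters below; density of the intersection
  gives one since the zero function lies in the space.
\<close>

lemma Baire_hoelder_space:
  fixes F :: "'a::metric_space set"
  assumes "compact F" "0 \<le> \<alpha>" "F \<noteq> {}" "countable \<G>"
    and "\<And>T. T \<in> \<G> \<Longrightarrow> openin (mtopology_of (hoelder_space \<alpha> F)) T"
    and "\<And>T. T \<in> \<G> \<Longrightarrow> mtopology_of (hoelder_space \<alpha> F) closure_of T = mspace (hoelder_space \<alpha> F)"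
  shows "\<exists>h\<in>hoelder_functions 1 \<alpha> F. h \<in> \<Inter>\<G>"
proof -
  let ?H = "hoelder_space \<alpha> F"
  interpret H: Metric_space "mspace ?H" "mdist ?H"
    by (rule Metric_space_mspace_mdist)
  have H: "mspace ?H = hoelder_functions 1 \<alpha> F"
    using mspace_hoelder_space[OF assms(1,2)] .
  have "H.mtopology closure_of \<Inter>\<G> = mspace ?H"
    using mcomplete_hoelder_space[OF assms(1-3)] assms(4-6)
    unfolding mcomplete_of_def mtopology_of_def by (intro H.metric_Baire_category conjI) 
  moreover have "restrict (\<lambda>_. 0) F \<in> mspace ?H"
    by (auto simp: H hoelder_functions_def hoelder_on_def)
  ultimately have "restrict (\<lambda>_. 0) F \<in> H.mtopology closure_of \<Inter>\<G>" by (simp only:)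
  then have "\<forall>r>0. \<exists>h\<in>\<Inter>\<G>. h \<in> H.mball (restrict (\<lambda>_. 0) F) r"
    unfolding H.metric_closure_of mem_Collect_eq by (rule conjunct2)
  then obtain h where h: "h \<in> \<Inter>\<G>" "h \<in> H.mball (restrict (\<lambda>_. 0) F) 1"
    using zero_less_one by (elim allE impE bexE)
  have "h \<in> hoelder_functions 1 \<alpha> F"
    using h(2) unfolding H.in_mball unfolding H by (elim conjE)
  with h(1) show ?thesis by (intro bexI)
qed

section \<open>Functions with negligible range\<close>

lemma hausdorff_dim_empty: "hausdorff_dim ({} :: 'a::metric_space set) = 0"
proof -
  have "hausdorff_content 0 \<delta> ({} :: 'a set) = 0" if "\<delta> > 0" for \<delta>
  proof -
    have "(\<lambda>_. {}) \<in> delta_covers \<delta> ({} :: 'a set)"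
      using that by (auto simp: delta_covers_def)
    then have "hausdorff_content 0 \<delta> ({} :: 'a set) \<le> (\<Sum>n. diam_pow 0 ({} :: 'a set))"
      unfolding hausdorff_content_def by (rule INF_lower)
    then show ?thesis by (simp add: diam_pow_def)
  qed
  then have "hausdorff_measure 0 ({} :: 'a set) = 0"
    unfolding hausdorff_measure_def by (auto simp: SUP_eq_iff)
  then have "hausdorff_dim ({} :: 'a set) \<le> ennreal 0"
    unfolding hausdorff_dim_def by (intro Inf_lower) (auto simp del: ennreal_0)
  then show ?thesis by simp
qed

text \<open>
  Outside the range of \<open>h\<close> the level sets are empty and have dimension zero. So for \<open>d > 0\<close> the
  levels of dimension at least \<open>d\<close> lie in the range.
\<close>

lemma D_star_fun_eq_0_if_negligible_image:
  assumes "negligible (h ` F)"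
  shows "D_star_fun h F = 0"
proof -
  have "ennreal d = 0"
    if "0 \<le> d" and pos: "outer_measure_of lebesgue {r. level_dim h r F \<ge> ennreal d} > 0" for d
  proof (rule ccontr)
    assume d: "ennreal d \<noteq> 0"
    have "{r. level_dim h r F \<ge> ennreal d} \<subseteq> h ` F"
    proof
      fix r assume r: "r \<in> {r. level_dim h r F \<ge> ennreal d}"
      show "r \<in> h ` F"
      proof (rule ccontr)
        assume "r \<notin> h ` F"
        then have "{x \<in> F. h x = r} = {}" by auto
        then have "level_dim h r F = 0"
          unfolding level_dim_def by (simp only: hausdorff_dim_empty)
        with r d show False by simp
      qed
    qed
    then have "outer_measure_of lebesgue {r. level_dim h r F \<ge> ennreal d}
        \<le> outer_measure_of lebesgue (h ` F)"
      by (rule outer_measure_of_mono)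
    also have "\<dots> = 0"
      using assms outer_measure_of_eq[of "h ` F" lebesgue]
      unfolding negligible_iff_null_sets by (metis null_setsD1 null_setsD2)
    finally show False using pos by simp
  qed
  then have *: "u = 0" if "u \<in> {ennreal d | d. 0 \<le> d \<and>
      outer_measure_of lebesgue {r. level_dim h r F \<ge> ennreal d} > 0}" for u
    using that by blast
  have "D_star_fun h F \<le> 0"
    unfolding D_star_fun_def by (rule Sup_least, drule *, simp only: order_refl)
  then show ?thesis by simp
qed

text \<open>
  If functions with finite range are dense, then a negligible range is a generic property: it can be
  achieved together with any countable family of open dense conditions.
\<close>

lemma generic_negligible_image:
  fixes F :: "'a::metric_space set"
  assumes F: "compact F" "F \<noteq> {}" and \<alpha>: "0 < \<alpha>"
    and dense: "\<And>g \<epsilon>. g \<in> hoelder_functions 1 \<alpha> F \<Longrightarrow> \<epsilon> > 0 \<Longrightarrow>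
           \<exists>h\<in>hoelder_functions 1 \<alpha> F. finite (h ` F) \<and> (\<forall>x\<in>F. \<bar>g x - h x\<bar> \<le> \<epsilon>)"
    and \<G>: "countable \<G>"
      "\<And>T. T \<in> \<G> \<Longrightarrow> openin (mtopology_of (hoelder_space \<alpha> F)) T"
      "\<And>T. T \<in> \<G> \<Longrightarrow> mtopology_of (hoelder_space \<alpha> F) closure_of T = mspace (hoelder_space \<alpha> F)"
  shows "\<exists>h\<in>hoelder_functions 1 \<alpha> F. h \<in> \<Inter>\<G> \<and> negligible (h ` F)"
proof -
  let ?H = "hoelder_functions 1 \<alpha> F"
  \<comment> \<open>These sets are dense because a finite set has measure zero, and open because the image of \<open>F\<close>
    is compact: an open superset of almost the same measure contains the images of all nearby
    functions.\<close>
  define U where "U \<epsilon> = {h \<in> ?H. measure lebesgue (h ` F) < \<epsilon>}" for \<epsilon> :: real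
  have comp: "compact (h ` F)" if "h \<in> ?H" for h
    using compact_continuous_image[OF continuous_on_hoelder[OF \<alpha> that] F(1)] .
  have U_open: "openin (mtopology_of (hoelder_space \<alpha> F)) (U \<epsilon>)" for \<epsilon>
  proof (rule openin_hoelder_spaceI)
    fix g assume g: "g \<in> U \<epsilon>"
    then have gH: "g \<in> ?H" by (simp add: U_def)
    have gF: "g ` F \<in> lmeasurable"
      by (rule lmeasurable_compact[OF comp[OF gH]])
    obtain T where T: "open T" "g ` F \<subseteq> T" "T - g ` F \<in> lmeasurable"
      "emeasure lebesgue (T - g ` F) < ennreal (\<epsilon> - measure lebesgue (g ` F))"
      using sets_lebesgue_outer_open[OF fmeasurableD[OF gF], of "\<epsilon> - measure lebesgue (g ` F)"] g
      by (auto simp: U_def)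
    have T_eq: "T = g ` F \<union> (T - g ` F)"
      using T(2) by auto
    have T_lm: "T \<in> lmeasurable"
      by (subst T_eq) (intro fmeasurable.Un gF T(3))
    have "measure lebesgue (T - g ` F) < \<epsilon> - measure lebesgue (g ` F)"
      using T(3,4) by (simp add: emeasure_eq_measure2 ennreal_less_iff)
    moreover have "measure lebesgue T \<le> measure lebesgue (g ` F) + measure lebesgue (T - g ` F)"
      by (subst T_eq) (intro measure_Un_le fmeasurableD gF T(3))
    ultimately have T_less: "measure lebesgue T < \<epsilon>" by simp
    obtain r where r: "r > 0" "\<And>u v. u \<in> g ` F \<Longrightarrow> v \<in> - T \<Longrightarrow> r \<le> dist u v"
      using separate_compact_closed[OF comp[OF gH], of "- T"] T(1,2) by blast
    have "h \<in> U \<epsilon>" if h: "h \<in> ?H" "\<forall>x\<in>F. \<bar>g x - h x\<bar> < r" for h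
    proof -
      have "h ` F \<subseteq> T"
        using r(2) h(2) by (fastforce simp: dist_real_def)
      then have "measure lebesgue (h ` F) \<le> measure lebesgue T"
        using T_lm lmeasurable_compact[OF comp[OF h(1)]] by (intro measure_mono_fmeasurable) auto
      then show ?thesis using T_less h(1) by (simp add: U_def)
    qed
    with r(1) show "\<exists>r>0. \<forall>h\<in>?H. (\<forall>x\<in>F. \<bar>g x - h x\<bar> < r) \<longrightarrow> h \<in> U \<epsilon>"
      by blast
  qed (use F \<alpha> in \<open>auto simp: U_def\<close>)
  have U_dense: "mtopology_of (hoelder_space \<alpha> F) closure_of U \<epsilon> = mspace (hoelder_space \<alpha> F)"
    if "\<epsilon> > 0" for \<epsilon>
  proof (rule dense_in_hoelder_spaceI)
    fix g :: "'a \<Rightarrow> real" and e :: real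
    assume "g \<in> ?H" "e > 0"
    then obtain h where h: "h \<in> ?H" "finite (h ` F)" "\<forall>x\<in>F. \<bar>g x - h x\<bar> \<le> e"
      using dense by blast
    have "measure lebesgue (h ` F) = 0"
      using negligible_finite[OF h(2)] by (simp add: negligible_iff_measure)
    with h that show "\<exists>h\<in>U \<epsilon> \<inter> ?H. \<forall>x\<in>F. \<bar>g x - h x\<bar> \<le> e"
      by (auto simp: U_def)
  qed (use F \<alpha> in auto)
  have "\<exists>h\<in>?H. h \<in> \<Inter>(\<G> \<union> range (\<lambda>n. U (inverse (real (Suc n)))))"
    using F \<alpha> \<G> U_open U_dense by (intro Baire_hoelder_space) auto
  then obtain h where h: "h \<in> ?H" "h \<in> \<Inter>\<G>" "\<And>n. h \<in> U (inverse (real (Suc n)))"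
    by auto
  have "measure lebesgue (h ` F) \<le> 0"
  proof (rule ccontr)
    assume "\<not> ?thesis"
    then obtain n where "inverse (real (Suc n)) < measure lebesgue (h ` F)"
      using reals_Archimedean[of "measure lebesgue (h ` F)"] by auto
    with h(3)[of n] show False by (simp add: U_def)
  qed
  then have "negligible (h ` F)"
    using lmeasurable_compact[OF comp[OF h(1)]]
    by (simp add: negligible_iff_measure measure_le_0_iff)
  with h show ?thesis by blast
qed

section \<open>Density of functions with finite range\<close>

text \<open>
  Arbitrarily fine maps of the set onto finite subsets of itself that are \<open>\<beta>\<close>-Hoelder with a constant
  independent of the fineness \<open>\<eta>\<close>. Only a totally disconnected set can have them.
\<close>

definition has_hoelder_discretisations :: "real \<Rightarrow> 'a::metric_space set \<Rightarrow> bool" where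
  "has_hoelder_discretisations \<beta> F \<longleftrightarrow>
     (\<exists>C. \<forall>\<eta>>0. \<exists>p. p ` F \<subseteq> F \<and> finite (p ` F) \<and> (\<forall>x\<in>F. dist x (p x) \<le> \<eta>) \<and>
        (\<forall>x\<in>F. \<forall>y\<in>F. dist (p x) (p y) \<le> C * dist x y powr \<beta>))"

text \<open>
  Composing \<open>g\<close> itself with a discretisation would enlarge its Hoelder constant and, for \<open>\<beta> < 1\<close>,
  lower its exponent.
  After shrinking \<open>g\<close> slightly and making it Lipschitz, the constant is harmless: at large distances
  the discretisation is a tiny perturbation, and at small distances a \<open>\<beta>\<close>-Hoelder bound with any
  constant is stronger than an \<open>\<alpha>\<close>-Hoelder bound, because \<open>\<alpha> < \<beta>\<close>.
\<close>

lemma finite_valued_dense: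
  fixes F :: "'a::metric_space set"
  assumes F: "F \<noteq> {}" and \<alpha>: "0 < \<alpha>" "\<alpha> < \<beta>" "\<beta> \<le> 1"
    and disc: "has_hoelder_discretisations \<beta> F"
    and bdd: "bounded (g ` F)" and g: "hoelder_on 1 \<alpha> F g" and \<epsilon>: "0 < \<epsilon>"
  shows "\<exists>h. hoelder_on 1 \<alpha> F h \<and> finite (h ` F) \<and> (\<forall>x\<in>F. \<bar>g x - h x\<bar> \<le> \<epsilon>)"
proof -
  obtain B where B: "\<And>x. x \<in> F \<Longrightarrow> \<bar>g x\<bar> \<le> B" "0 < B"
    using bdd by (auto simp: bounded_pos)
  \<comment> \<open>Shrinking \<open>g\<close> by the factor \<open>1 - s\<close> leaves room for an error of \<open>s * dist x y powr \<alpha>\<close>.\<close>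
  define s where "s = min 1 (\<epsilon> / 3 / B)"
  have s: "0 < s" "s \<le> 1" "s * B \<le> \<epsilon> / 3"
    using \<epsilon> B(2) by (auto simp: s_def min_def field_simps)
  have "hoelder_on (1 - s) \<alpha> F (\<lambda>x. (1 - s) * g x)"
    unfolding hoelder_on_def
  proof (intro ballI)
    fix x y assume "x \<in> F" "y \<in> F"
    then have "\<bar>g x - g y\<bar> \<le> dist x y powr \<alpha>"
      using g by (auto simp: hoelder_on_def)
    moreover have "\<bar>(1 - s) * g x - (1 - s) * g y\<bar> = (1 - s) * \<bar>g x - g y\<bar>"
      using s by (simp add: abs_mult flip: right_diff_distrib)
    ultimately show "\<bar>(1 - s) * g x - (1 - s) * g y\<bar> \<le> (1 - s) * dist x y powr \<alpha>"
      using s by (simp add: mult_left_mono)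
  qed
  moreover have "bounded ((\<lambda>x. (1 - s) * g x) ` F)"
    using bounded_scaling[OF bdd, of "1 - s"] by (simp add: image_image)
  ultimately obtain k M where M: "0 \<le> M" and k: "hoelder_on (1 - s) \<alpha> F k" "hoelder_on M 1 F k"
    and gk: "\<And>x. x \<in> F \<Longrightarrow> \<bar>(1 - s) * g x - k x\<bar> \<le> \<epsilon> / 3"
    using lipschitz_approximation[OF F \<alpha>(1), of "1 - s" "\<epsilon> / 3" "\<lambda>x. (1 - s) * g x"] \<alpha> s \<epsilon>
    by force
  obtain C0 where C0: "\<And>\<eta>. \<eta> > 0 \<Longrightarrow> \<exists>p. p ` F \<subseteq> F \<and> finite (p ` F) \<and> (\<forall>x\<in>F. dist x (p x) \<le> \<eta>) \<and>
        (\<forall>x\<in>F. \<forall>y\<in>F. dist (p x) (p y) \<le> C0 * dist x y powr \<beta>)"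
    using disc unfolding has_hoelder_discretisations_def by blast
  \<comment> \<open>\<open>K\<close> bounds the \<open>\<beta>\<close>-Hoelder constant of \<open>k \<circ> p\<close> for every discretisation \<open>p\<close>; the maximum
    and the summand \<open>1\<close> only make it positive. At distances below \<open>\<delta>\<close> the resulting bound
    \<open>K * t powr \<beta>\<close> is at most \<open>t powr \<alpha>\<close>.\<close>
  define K where "K = M * max C0 0 + 1"
  have K: "0 < K" "M * C0 \<le> K"
    using M mult_left_mono[of C0 "max C0 0" M] mult_nonneg_nonneg[of M "max C0 0"]
    unfolding K_def by linarith+
  define \<delta> where "\<delta> = K powr (- (1 / (\<beta> - \<alpha>)))"
  have "\<delta> powr (\<beta> - \<alpha>) = K powr (- 1)"
    using \<alpha> by (simp add: \<delta>_def powr_powr)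
  then have \<delta>: "0 < \<delta>" "K * \<delta> powr (\<beta> - \<alpha>) = 1"
    using K by (auto simp: \<delta>_def powr_minus)
  \<comment> \<open>At distances above \<open>\<delta>\<close>, moving both points by at most \<open>\<eta>\<close> changes \<open>k x - k y\<close> by at most
    the room \<open>s * \<delta> powr \<alpha>\<close>.\<close>
  define \<eta> where "\<eta> = min (\<epsilon> / 3) (s * \<delta> powr \<alpha> / 2) / (M + 1)"
  have \<eta>: "0 < \<eta>" using M s \<delta> \<epsilon> by (auto simp: \<eta>_def)
  have "M * \<eta> \<le> (M + 1) * \<eta>" using \<eta> by simp
  also have "\<dots> = min (\<epsilon> / 3) (s * \<delta> powr \<alpha> / 2)" using M by (simp add: \<eta>_def)
  finally have M\<eta>: "M * \<eta> \<le> \<epsilon> / 3" "2 * (M * \<eta>) \<le> s * \<delta> powr \<alpha>" by auto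
  obtain p where p: "p ` F \<subseteq> F" "finite (p ` F)" "\<And>x. x \<in> F \<Longrightarrow> dist x (p x) \<le> \<eta>"
    "\<And>x y. x \<in> F \<Longrightarrow> y \<in> F \<Longrightarrow> dist (p x) (p y) \<le> C0 * dist x y powr \<beta>"
    using C0[OF \<eta>] by blast
  have pF: "p x \<in> F" if "x \<in> F" for x using p(1) that by blast
  have k_lip: "\<bar>k x - k y\<bar> \<le> M * dist x y" if "x \<in> F" "y \<in> F" for x y
    using k(2) that by (auto simp: hoelder_on_def)
  have kp: "\<bar>k x - k (p x)\<bar> \<le> M * \<eta>" if "x \<in> F" for x
    using k_lip[OF that pF[OF that]] mult_left_mono[OF p(3)[OF that] M] by linarith
  have "hoelder_on 1 \<alpha> F (k \<circ> p)"
    unfolding hoelder_on_def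
  proof (intro ballI)
    fix x y assume xy: "x \<in> F" "y \<in> F"
    show "\<bar>(k \<circ> p) x - (k \<circ> p) y\<bar> \<le> 1 * dist x y powr \<alpha>"
    proof (cases "\<delta> \<le> dist x y")
      case True
      have "\<bar>k x - k y\<bar> \<le> (1 - s) * dist x y powr \<alpha>"
        using k(1) xy by (auto simp: hoelder_on_def)
      moreover have "2 * (M * \<eta>) \<le> s * dist x y powr \<alpha>"
        using M\<eta>(2) mult_left_mono[OF powr_mono2[of \<alpha> \<delta> "dist x y"], of s] True s \<alpha> \<delta> by linarith
      moreover have "\<bar>k (p x) - k (p y)\<bar> \<le> \<bar>k x - k y\<bar> + 2 * (M * \<eta>)"
        using kp[OF xy(1)] kp[OF xy(2)] by linarith
      ultimately show ?thesis by (simp add: left_diff_distrib)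
    next
      case False
      have "\<bar>k (p x) - k (p y)\<bar> \<le> M * (C0 * dist x y powr \<beta>)"
        using k_lip[OF pF[OF xy(1)] pF[OF xy(2)]] mult_left_mono[OF p(4)[OF xy] M] by linarith
      also have "\<dots> \<le> K * dist x y powr \<beta>"
        using mult_right_mono[OF K(2), of "dist x y powr \<beta>"] by (simp add: mult.assoc)
      also have "\<dots> = K * dist x y powr (\<beta> - \<alpha>) * dist x y powr \<alpha>"
        by (simp add: mult.assoc flip: powr_add)
      also have "\<dots> \<le> K * \<delta> powr (\<beta> - \<alpha>) * dist x y powr \<alpha>"
        using False K \<alpha> by (intro mult_right_mono mult_left_mono powr_mono2) auto
      finally show ?thesis using \<delta>(2) by simp
    qed
  qed
  moreover have "finite ((k \<circ> p) ` F)"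
    using finite_imageI[OF p(2), of k] by (simp only: image_comp)
  moreover have "\<bar>g x - (k \<circ> p) x\<bar> \<le> \<epsilon>" if x: "x \<in> F" for x
  proof -
    have "\<bar>g x - (1 - s) * g x\<bar> = s * \<bar>g x\<bar>"
      using s by (simp add: algebra_simps abs_mult)
    also have "\<dots> \<le> \<epsilon> / 3"
      using mult_left_mono[OF B(1)[OF x], of s] s by linarith
    finally show ?thesis
      using gk[OF x] kp[OF x] M\<eta>(1) unfolding o_apply by linarith
  qed
  ultimately show ?thesis by blast
qed

text \<open>
  The previous result for functions that are \<^const>\<open>undefined\<close> outside \<open>F\<close>.
\<close>

lemma finite_valued_dense_in_hoelder_functions:
  fixes F :: "'a::metric_space set"
  assumes F: "compact F" "F \<noteq> {}" and \<alpha>: "0 < \<alpha>" "\<alpha> < \<beta>" "\<beta> \<le> 1"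
    and disc: "has_hoelder_discretisations \<beta> F"
    and g: "g \<in> hoelder_functions 1 \<alpha> F" and \<epsilon>: "\<epsilon> > 0"
  shows "\<exists>h\<in>hoelder_functions 1 \<alpha> F. finite (h ` F) \<and> (\<forall>x\<in>F. \<bar>g x - h x\<bar> \<le> \<epsilon>)"
proof -
  have "bounded (g ` F)"
    using F(1) g \<alpha> by (intro bounded_hoelder_image[of F \<alpha> g 1]) auto
  moreover have "hoelder_on 1 \<alpha> F g"
    using g by (simp add: hoelder_functions_def)
  ultimately obtain h where h: "hoelder_on 1 \<alpha> F h" "finite (h ` F)"
    "\<forall>x\<in>F. \<bar>g x - h x\<bar> \<le> \<epsilon>"
    using finite_valued_dense[OF F(2) \<alpha> disc _ _ \<epsilon>] by blast
  then have "restrict h F \<in> hoelder_functions 1 \<alpha> F"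
    by (simp add: hoelder_functions_def hoelder_on_def)
  moreover have "restrict h F ` F = h ` F"
    by simp
  ultimately show ?thesis
    using h by (intro bexI[of _ "restrict h F"]) simp_all
qed

section \<open>Vanishing of the generic and the lower dimension\<close>

text \<open>
  Every dense \<open>G\<^sub>\<delta>\<close> set is an intersection of countably many open dense sets, so it contains a
  function with negligible range.
\<close>

lemma D_star_eq_0:
  fixes F :: "'a::metric_space set"
  assumes F: "compact F" "F \<noteq> {}" and \<alpha>: "0 < \<alpha>" "\<alpha> < \<beta>" "\<beta> \<le> 1"
    and disc: "has_hoelder_discretisations \<beta> F"
  shows "D_star \<alpha> F = 0"
proof -
  let ?T = "mtopology_of (hoelder_space \<alpha> F)"
  have "(INF h\<in>G. D_star_fun h F) \<le> 0" if G: "G \<in> dense_gdeltas \<alpha> F" for G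
  proof -
    obtain \<U> where \<U>: "countable \<U>" "\<And>U. U \<in> \<U> \<Longrightarrow> openin ?T U" "\<Inter>\<U> = G"
      using G unfolding dense_gdeltas_def gdelta_in_alt intersection_of_def by blast
    have "?T closure_of U = mspace (hoelder_space \<alpha> F)" if "U \<in> \<U>" for U
    proof
      have "?T closure_of G \<subseteq> ?T closure_of U"
        using \<U>(3) that by (intro closure_of_mono) blast
      then show "mspace (hoelder_space \<alpha> F) \<subseteq> ?T closure_of U"
        using G by (simp add: dense_gdeltas_def)
      show "?T closure_of U \<subseteq> mspace (hoelder_space \<alpha> F)"
        using closure_of_subset_topspace[of ?T U] by (simp only: topspace_mtopology_of)
    qed
    then obtain h where "h \<in> \<Inter>\<U>" "negligible (h ` F)"
      using generic_negligible_image[OF F \<alpha>(1) finite_valued_dense_in_hoelder_functions[OF F \<alpha> disc] \<U>(1,2)]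
      by blast
    then show ?thesis
      using \<U>(3) INF_lower[of h G "\<lambda>h. D_star_fun h F"]
      by (simp only: D_star_fun_eq_0_if_negligible_image)
  qed
  then have "D_star \<alpha> F \<le> 0"
    unfolding D_star_def by (rule SUP_least)
  then show ?thesis by simp
qed

lemma perturb_nonconstant:
  fixes F :: "'a::metric_space set"
  assumes F: "compact F" and \<alpha>: "0 < \<alpha>" "\<alpha> \<le> 1" and B: "a \<in> B" "b \<in> B" "a \<noteq> b"
    and g: "hoelder_on 1 \<alpha> F g" and \<epsilon>: "\<epsilon> > 0" and bdd: "bounded (g ` F)"
  shows "\<exists>h. hoelder_on 1 \<alpha> F h \<and> \<not> h constant_on B \<and> (\<forall>x\<in>F. \<bar>g x - h x\<bar> \<le> \<epsilon>)"
proof (cases "g constant_on B")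
  case False
  with g \<epsilon> show ?thesis by (intro exI[of _ g]) simp
next
  case True
  \<comment> \<open>\<open>k\<close> is 1-Hoelder by the triangle inequality for the modulus, and it separates \<open>a\<close> from \<open>b\<close>.
    As \<open>g\<close> is constant on \<open>B\<close>, every convex combination of \<open>g\<close> and \<open>k\<close> with positive weight
    on \<open>k\<close> separates them too.\<close>
  define k where "k x = modulus \<alpha> 1 (dist x a)" for x
  have k: "\<bar>k x - k y\<bar> \<le> dist x y powr \<alpha>" for x y
    using modulus_dist_triangle[of 1 \<alpha> x a y] modulus_dist_triangle[of 1 \<alpha> y a x]
      modulus_le_powr[of \<alpha> "dist x y" 1] \<alpha> by (simp add: k_def dist_commute)
  have k_diff: "k a \<noteq> k b"
    using B(3) by (simp add: k_def modulus_def)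
  obtain A where A: "\<And>x. x \<in> F \<Longrightarrow> \<bar>g x\<bar> \<le> A" "0 < A"
    using bdd by (auto simp: bounded_pos)
  obtain e where e: "\<forall>x\<in>F. dist a x \<le> e"
    using compact_imp_bounded[OF F] unfolding bounded_any_center[of F a] by (rule exE)
  define D where "D = max e 1"
  have D: "dist x a \<le> D" if "x \<in> F" for x
    using bspec[OF e that] by (simp add: D_def dist_commute)
  have k_le: "\<bar>k x\<bar> \<le> D powr \<alpha>" if "x \<in> F" for x
    using k[of x a] powr_mono2[of \<alpha> "dist x a" D] D that \<alpha> by (simp add: k_def modulus_def)
  define K where "K = A + D powr \<alpha>"
  have "0 < K" using A(2) by (simp add: K_def add_pos_nonneg)
  define s where "s = min 1 (\<epsilon> / K)"
  have s: "0 < s" "s \<le> 1" "s * K \<le> \<epsilon>"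
    using \<epsilon> \<open>0 < K\<close> by (auto simp: s_def min_def field_simps)
  define h where "h x = (1 - s) * g x + s * k x" for x
  have "hoelder_on 1 \<alpha> F h"
    unfolding hoelder_on_def
  proof (intro ballI)
    fix x y assume "x \<in> F" "y \<in> F"
    then have "\<bar>g x - g y\<bar> \<le> dist x y powr \<alpha>"
      using g by (auto simp: hoelder_on_def)
    then have "(1 - s) * \<bar>g x - g y\<bar> + s * \<bar>k x - k y\<bar>
        \<le> (1 - s) * dist x y powr \<alpha> + s * dist x y powr \<alpha>"
      using s k by (intro add_mono mult_left_mono) auto
    moreover have "(1 - s) * dist x y powr \<alpha> + s * dist x y powr \<alpha> = 1 * dist x y powr \<alpha>"
      by (simp add: algebra_simps)
    moreover have "h x - h y = (1 - s) * (g x - g y) + s * (k x - k y)"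
      by (simp add: h_def algebra_simps)
    moreover have "\<bar>(1 - s) * (g x - g y)\<bar> = (1 - s) * \<bar>g x - g y\<bar>"
      "\<bar>s * (k x - k y)\<bar> = s * \<bar>k x - k y\<bar>"
      using s by (simp_all add: abs_mult)
    ultimately show "\<bar>h x - h y\<bar> \<le> 1 * dist x y powr \<alpha>"
      by linarith
  qed
  moreover have "\<not> h constant_on B"
  proof
    assume "h constant_on B"
    then have "h a = h b" "g a = g b"
      using True B(1,2) by (auto simp: constant_on_def)
    then show False using s k_diff by (simp add: h_def)
  qed
  moreover have "\<bar>g x - h x\<bar> \<le> \<epsilon>" if x: "x \<in> F" for x
  proof -
    have "g x - h x = s * (g x - k x)"
      by (simp add: h_def algebra_simps)
    then have "\<bar>g x - h x\<bar> = s * \<bar>g x - k x\<bar>"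
      using s by (simp add: abs_mult)
    also have "\<dots> \<le> s * K"
      unfolding K_def using s A(1)[OF x] k_le[OF x] by (intro mult_left_mono) auto
    finally show ?thesis using s by linarith
  qed
  ultimately show ?thesis by blast
qed

lemma nonconstant_openin:
  fixes F :: "'a::metric_space set"
  assumes "compact F" "0 < \<alpha>" "F \<noteq> {}" "B \<subseteq> F"
  shows "openin (mtopology_of (hoelder_space \<alpha> F)) {h \<in> hoelder_functions 1 \<alpha> F. \<not> h constant_on B}"
proof (rule openin_hoelder_spaceI)
  fix g assume "g \<in> {h \<in> hoelder_functions 1 \<alpha> F. \<not> h constant_on B}"
  then obtain x y where xy: "x \<in> B" "y \<in> B" "g x \<noteq> g y"
    unfolding constant_on_def by blast
  have "\<not> h constant_on B"
    if "\<forall>z\<in>F. \<bar>g z - h z\<bar> < \<bar>g x - g y\<bar> / 2" for h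
  proof
    assume "h constant_on B"
    then have "h x = h y" using xy by (auto simp: constant_on_def)
    moreover have "dist (h x) (g x) < dist (g x) (g y) / 2" "dist (h y) (g y) < dist (g x) (g y) / 2"
      using that xy assms(4) by (auto simp: dist_real_def abs_minus_commute)
    ultimately show False
      using dist_triangle_half_r[of "h x" "g x" "dist (g x) (g y)" "g y"] by simp
  qed
  then show "\<exists>r>0. \<forall>h\<in>hoelder_functions 1 \<alpha> F. (\<forall>x\<in>F. \<bar>g x - h x\<bar> < r) \<longrightarrow>
      h \<in> {h \<in> hoelder_functions 1 \<alpha> F. \<not> h constant_on B}"
    using xy by (intro exI[of _ "\<bar>g x - g y\<bar> / 2"]) simp
qed (use assms in auto)

lemma nonconstant_dense:
  fixes F :: "'a::metric_space set"
  assumes F: "compact F" "F \<noteq> {}" and \<alpha>: "0 < \<alpha>" "\<alpha> \<le> 1" and B: "B \<subseteq> F" "a \<in> B" "b \<in> B" "a \<noteq> b"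
  shows "mtopology_of (hoelder_space \<alpha> F) closure_of {h \<in> hoelder_functions 1 \<alpha> F. \<not> h constant_on B} =
    mspace (hoelder_space \<alpha> F)"
proof (rule dense_in_hoelder_spaceI)
  fix g :: "'a \<Rightarrow> real" and \<epsilon> :: real
  assume g: "g \<in> hoelder_functions 1 \<alpha> F" and \<epsilon>: "\<epsilon> > 0"
  have "bounded (g ` F)"
    using F(1) g \<alpha> by (intro bounded_hoelder_image[of F \<alpha> g 1]) auto
  moreover have "hoelder_on 1 \<alpha> F g"
    using g by (simp add: hoelder_functions_def)
  ultimately obtain h where h: "hoelder_on 1 \<alpha> F h" "\<not> h constant_on B" "\<forall>x\<in>F. \<bar>g x - h x\<bar> \<le> \<epsilon>"
    using perturb_nonconstant[OF F(1) \<alpha> B(2-4) _ \<epsilon>] by blast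
  then have "restrict h F \<in> hoelder_functions 1 \<alpha> F"
    by (simp add: hoelder_functions_def hoelder_on_def)
  moreover have "\<not> restrict h F constant_on B"
    using h(2) B(1) unfolding constant_on_def by (metis restrict_apply' subsetD)
  ultimately show "\<exists>h\<in>{h \<in> hoelder_functions 1 \<alpha> F. \<not> h constant_on B} \<inter> hoelder_functions 1 \<alpha> F.
      \<forall>x\<in>F. \<bar>g x - h x\<bar> \<le> \<epsilon>"
    using h by (intro bexI[of _ "restrict h F"]) simp_all
qed (use F \<alpha> in auto)

text \<open>
  Being locally non-constant is itself generic, so it is compatible with having a negligible range.
\<close>

lemma D_star_lower_eq_0:
  fixes F :: "'a::{metric_space, second_countable_topology} set"
  assumes F: "compact F" "F \<noteq> {}" and \<alpha>: "0 < \<alpha>" "\<alpha> < \<beta>" "\<beta> \<le> 1"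
    and disc: "has_hoelder_discretisations \<beta> F"
  shows "D_star_lower \<alpha> F = 0"
proof -
  let ?T = "mtopology_of (hoelder_space \<alpha> F)"
  obtain \<B> :: "'a set set" where \<B>: "countable \<B>" "topological_basis \<B>"
    using ex_countable_basis by blast
  \<comment> \<open>Countably many conditions suffice: every neighbourhood of an accumulation point contains a
    basic open set that meets \<open>F\<close> in two points.\<close>
  define nonconst where "nonconst B = {h \<in> hoelder_functions 1 \<alpha> F. \<not> h constant_on (B \<inter> F)}" for B
  define \<G> where "\<G> = nonconst ` {B \<in> \<B>. \<exists>a b. a \<in> B \<inter> F \<and> b \<in> B \<inter> F \<and> a \<noteq> b}"
  have open_G: "openin ?T T" if "T \<in> \<G>" for T
    using that nonconstant_openin[OF F(1) \<alpha>(1) F(2)] unfolding \<G>_def nonconst_def by blast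
  have dense_G: "?T closure_of T = mspace (hoelder_space \<alpha> F)" if T: "T \<in> \<G>" for T
  proof -
    obtain B a b where "T = nonconst B" "a \<in> B \<inter> F" "b \<in> B \<inter> F" "a \<noteq> b"
      using T unfolding \<G>_def by blast
    then show ?thesis
      using nonconstant_dense[OF F \<alpha>(1), of "B \<inter> F" a b] \<alpha> unfolding nonconst_def by simp
  qed
  have "countable \<G>"
    using \<B>(1) by (simp add: \<G>_def)
  then have "\<exists>h\<in>hoelder_functions 1 \<alpha> F. h \<in> \<Inter>\<G> \<and> negligible (h ` F)"
    using generic_negligible_image[OF F \<alpha>(1) finite_valued_dense_in_hoelder_functions[OF F \<alpha> disc]]
      open_G dense_G by (simp only:)
  then obtain h where h: "h \<in> hoelder_functions 1 \<alpha> F" "h \<in> \<Inter>\<G>" "negligible (h ` F)"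
    by (elim bexE conjE)
  have "locally_nonconstant F h"
    unfolding locally_nonconstant_def
  proof (intro allI impI, elim conjE)
    fix x U assume x: "x islimpt F" "x \<in> interior U"
    obtain B where B: "B \<in> \<B>" "x \<in> B" "B \<subseteq> interior U"
      using topological_basisE[OF \<B>(2) open_interior x(2)] by blast
    have open_B: "open B"
      using topological_basis_open[OF \<B>(2) B(1)] .
    obtain a where a: "a \<in> F" "a \<in> B" "a \<noteq> x"
      using x(1) B(2) open_B unfolding islimpt_def by blast
    obtain b where b: "b \<in> F" "b \<in> B - {a}"
      using x(1) B(2) open_B a(3) unfolding islimpt_def
      by (metis Diff_iff open_delete singletonD)
    have "nonconst B \<in> \<G>"
      unfolding \<G>_def using B(1) a b by blast
    then have "h \<in> nonconst B" using h(2) by (rule InterD[rotated])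
    then have "\<not> h constant_on (B \<inter> F)" by (simp add: nonconst_def)
    moreover have "B \<inter> F \<subseteq> U \<inter> F"
      using B(3) interior_subset by blast
    ultimately show "\<not> h constant_on (U \<inter> F)"
      using constant_on_subset by blast
  qed
  with h(1) have hL: "h \<in> {h \<in> hoelder_functions 1 \<alpha> F. locally_nonconstant F h}" (is "_ \<in> ?L")
    by simp
  then have "?L \<noteq> {}" by (rule ex_in_conv[THEN iffD1, OF exI])
  then have "D_star_lower \<alpha> F = (INF h\<in>?L. D_star_fun h F)"
    unfolding D_star_lower_def Let_def by (rule if_not_P)
  also have "\<dots> \<le> D_star_fun h F"
    using hL by (rule INF_lower)
  also have "\<dots> = 0"
    by (rule D_star_fun_eq_0_if_negligible_image[OF h(3)])
  finally show ?thesis by simp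
qed

section \<open>Discretisations of attractors\<close>

lemma uniform_gap:
  fixes A :: "'i \<Rightarrow> 'a::heine_borel set"
  assumes "finite I" "\<And>i. i \<in> I \<Longrightarrow> compact (A i)" "disjoint_family_on A I"
  shows "\<exists>d>0. \<forall>i\<in>I. \<forall>j\<in>I. i \<noteq> j \<longrightarrow> (\<forall>x\<in>A i. \<forall>y\<in>A j. d \<le> dist x y)"
proof -
  define P where "P = {p \<in> I \<times> I. fst p \<noteq> snd p}"
  have "\<forall>p\<in>P. \<exists>d>0. \<forall>x\<in>A (fst p). \<forall>y\<in>A (snd p). d \<le> dist x y"
  proof
    fix p assume p: "p \<in> P"
    then have "A (fst p) \<inter> A (snd p) = {}"
      by (intro disjoint_family_onD[OF assms(3)]) (auto simp: P_def)
    then show "\<exists>d>0. \<forall>x\<in>A (fst p). \<forall>y\<in>A (snd p). d \<le> dist x y"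
      using p assms(2) by (intro separate_compact_closed compact_imp_closed) (auto simp: P_def)
  qed
  then obtain d where d: "\<forall>p\<in>P. d p > 0 \<and> (\<forall>x\<in>A (fst p). \<forall>y\<in>A (snd p). d p \<le> dist x y)"
    by (rule bchoice[THEN exE])
  have fin: "finite (insert 1 (d ` P))"
    using assms(1) by (simp add: P_def)
  show ?thesis
  proof (intro exI conjI ballI impI)
    show "0 < Min (insert 1 (d ` P))"
      using d fin by (subst Min_gr_iff) auto
    fix i j x y assume ij: "i \<in> I" "j \<in> I" "i \<noteq> j" and xy: "x \<in> A i" "y \<in> A j"
    then have P: "(i, j) \<in> P" by (simp add: P_def)
    then have "Min (insert 1 (d ` P)) \<le> d (i, j)"
      using fin by (intro Min_le) auto
    also have "\<dots> \<le> dist x y"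
      using bspec[OF d P] xy by auto
    finally show "Min (insert 1 (d ` P)) \<le> dist x y" .
  qed
qed

text \<open>
  The discretisations arise by iterating the system from a constant map. The condition
  \<open>\<rho> i \<le> \<nu> i powr \<beta>\<close> is exactly what keeps the Hoelder constant from growing when a discretisation
  is copied into the pieces \<open>f i ` F\<close>. For similarities it holds with \<open>\<beta> = 1\<close>.
\<close>

lemma attractor_has_hoelder_discretisations:
  fixes F :: "'a::heine_borel set" and f :: "nat \<Rightarrow> 'a \<Rightarrow> 'a"
  assumes m: "1 \<le> m" and F: "compact F" "F \<noteq> {}" "F = (\<Union>i\<in>{1..m}. f i ` F)"
    and sep: "strong_separation m f F" and \<beta>: "0 < \<beta>"
    and \<rho>\<nu>: "\<And>i. i \<in> {1..m} \<Longrightarrow> 0 < \<rho> i \<and> \<rho> i < 1 \<and> 0 < \<nu> i \<and> \<rho> i \<le> \<nu> i powr \<beta>"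
    and upper: "\<And>i x y. i \<in> {1..m} \<Longrightarrow> x \<in> F \<Longrightarrow> y \<in> F \<Longrightarrow> dist (f i x) (f i y) \<le> \<rho> i * dist x y"
    and lower: "\<And>i x y. i \<in> {1..m} \<Longrightarrow> x \<in> F \<Longrightarrow> y \<in> F \<Longrightarrow> \<nu> i * dist x y \<le> dist (f i x) (f i y)"
  shows "has_hoelder_discretisations \<beta> F"
proof -
  have "compact (f i ` F)" if i: "i \<in> {1..m}" for i
  proof (rule compact_continuous_image[OF _ F(1)])
    have "(\<rho> i)-lipschitz_on F (f i)"
      using upper[OF i] \<rho>\<nu>[OF i] by (intro lipschitz_onI) auto
    then show "continuous_on F (f i)" by (rule lipschitz_on_continuous_on)
  qed
  then obtain d where d: "d > 0"
    "\<And>i j x y. i \<in> {1..m} \<Longrightarrow> j \<in> {1..m} \<Longrightarrow> i \<noteq> j \<Longrightarrow> x \<in> f i ` F \<Longrightarrow> y \<in> f j ` F \<Longrightarrow> d \<le> dist x y"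
    using uniform_gap[of "{1..m}" "\<lambda>i. f i ` F"] sep unfolding strong_separation_def by (metis finite_atLeastAtMost)
  obtain D where D: "D > 0" "\<And>x y. x \<in> F \<Longrightarrow> y \<in> F \<Longrightarrow> dist x y \<le> D"
  proof
    show "0 < diameter F + 1"
      using diameter_ge_0[OF compact_imp_bounded[OF F(1)]] by linarith
    show "dist x y \<le> diameter F + 1" if "x \<in> F" "y \<in> F" for x y
      using diameter_bounded_bound[OF compact_imp_bounded[OF F(1)] that] by linarith
  qed
  define r where "r = Max (\<rho> ` {1..m})"
  have r: "0 < r" "r < 1" "\<And>i. i \<in> {1..m} \<Longrightarrow> \<rho> i \<le> r"
  proof -
    show le: "\<rho> i \<le> r" if "i \<in> {1..m}" for i
      using that by (simp add: r_def)
    have "r \<in> \<rho> ` {1..m}"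
      unfolding r_def using m by (intro Max_in) auto
    then show "0 < r" "r < 1" using \<rho>\<nu> by auto
  qed
  \<comment> \<open>This constant makes the bound trivial for two points in different pieces: such points have
    distance at least \<open>d\<close>, and their images have distance at most \<open>D\<close>.\<close>
  define C where "C = D / d powr \<beta>"
  have C: "0 < C" "C * d powr \<beta> = D"
    using D d by (auto simp: C_def)
  have "\<forall>x\<in>F. \<exists>iq. fst iq \<in> {1..m} \<and> snd iq \<in> F \<and> f (fst iq) (snd iq) = x"
  proof
    fix x assume "x \<in> F"
    then have "x \<in> (\<Union>i\<in>{1..m}. f i ` F)" using F(3) by blast
    then obtain i q where "i \<in> {1..m}" "q \<in> F" "f i q = x" by blast
    then show "\<exists>iq. fst iq \<in> {1..m} \<and> snd iq \<in> F \<and> f (fst iq) (snd iq) = x"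
      by (intro exI[of _ "(i, q)"]) simp
  qed
  then obtain iq where iq: "\<forall>x\<in>F. fst (iq x) \<in> {1..m} \<and> snd (iq x) \<in> F \<and> f (fst (iq x)) (snd (iq x)) = x"
    by (rule bchoice[THEN exE])
  define I where "I x = fst (iq x)" for x
  define q where "q x = snd (iq x)" for x
  have I: "I x \<in> {1..m}" and q: "q x \<in> F" and fq: "f (I x) (q x) = x" if "x \<in> F" for x
    using bspec[OF iq that] by (simp_all add: I_def q_def)
  have fF: "f i x \<in> F" if "i \<in> {1..m}" "x \<in> F" for i x
    using that F(3) by blast
  have discretise: "\<exists>p. p ` F \<subseteq> F \<and> finite (p ` F) \<and> (\<forall>x\<in>F. dist x (p x) \<le> r ^ n * D) \<and>
      (\<forall>x\<in>F. \<forall>y\<in>F. dist (p x) (p y) \<le> C * dist x y powr \<beta>)" for n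
  proof (induction n)
    case 0
    obtain a where "a \<in> F" using F(2) by blast
    then show ?case
      using D C F(2) by (intro exI[of _ "\<lambda>_. a"]) (auto simp: image_constant_conv)
  next
    case (Suc n)
    then obtain p where p: "p ` F \<subseteq> F" "finite (p ` F)" "\<And>x. x \<in> F \<Longrightarrow> dist x (p x) \<le> r ^ n * D"
      "\<And>x y. x \<in> F \<Longrightarrow> y \<in> F \<Longrightarrow> dist (p x) (p y) \<le> C * dist x y powr \<beta>"
      by blast
    have pF: "p x \<in> F" if "x \<in> F" for x using p(1) that by blast
    \<comment> \<open>Push the discretisation forward to each piece. Inside the piece \<open>i\<close> the images come closer by
    the factor \<open>\<rho> i\<close>, while \<open>dist x y powr \<beta>\<close> decreases at most by the factor \<open>\<nu> i powr \<beta>\<close>.\<close>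
    define p' where "p' x = f (I x) (p (q x))" for x
    have p'F: "p' x \<in> F" if "x \<in> F" for x
      unfolding p'_def by (intro fF I pF q that)
    have "p' ` F \<subseteq> (\<Union>i\<in>{1..m}. f i ` p ` F)"
      using I q unfolding p'_def by blast
    then have "finite (p' ` F)"
      by (rule finite_subset) (simp add: p(2))
    moreover have "dist x (p' x) \<le> r ^ Suc n * D" if x: "x \<in> F" for x
    proof -
      have "dist x (p' x) = dist (f (I x) (q x)) (f (I x) (p (q x)))"
        using fq[OF x] by (simp add: p'_def)
      also have "\<dots> \<le> \<rho> (I x) * dist (q x) (p (q x))"
        by (intro upper I q pF x)
      also have "\<dots> \<le> r * (r ^ n * D)"
        by (intro mult_mono r(3) I p(3) q x) (use r(1) in auto)
      finally show ?thesis by (simp add: mult.assoc)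
    qed
    moreover have "dist (p' x) (p' y) \<le> C * dist x y powr \<beta>" if xy: "x \<in> F" "y \<in> F" for x y
    proof (cases "I x = I y")
      case True
      let ?i = "I x"
      have i: "?i \<in> {1..m}" using I xy by blast
      have "\<nu> ?i * dist (q x) (q y) \<le> dist (f ?i (q x)) (f ?i (q y))"
        by (intro lower i q xy)
      then have expand: "\<nu> ?i * dist (q x) (q y) \<le> dist x y"
        using fq[OF xy(1)] fq[OF xy(2)] True by simp
      have "dist (p' x) (p' y) \<le> \<rho> ?i * dist (p (q x)) (p (q y))"
        unfolding p'_def True[symmetric] by (intro upper i q pF xy)
      also have "\<dots> \<le> \<nu> ?i powr \<beta> * (C * dist (q x) (q y) powr \<beta>)"
        using \<rho>\<nu>[OF i] by (intro mult_mono p(4) q xy) auto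
      also have "\<dots> = C * (\<nu> ?i * dist (q x) (q y)) powr \<beta>"
        using \<rho>\<nu>[OF i] by (simp add: powr_mult)
      also have "\<dots> \<le> C * dist x y powr \<beta>"
        using C \<beta> \<rho>\<nu>[OF i] expand by (intro mult_left_mono powr_mono2) auto
      finally show ?thesis .
    next
      case False
      have "x \<in> f (I x) ` F" "y \<in> f (I y) ` F"
        using fq q xy by (metis imageI)+
      then have "d \<le> dist x y"
        using False I xy by (intro d(2)[of "I x" "I y"])
      then have "C * d powr \<beta> \<le> C * dist x y powr \<beta>"
        using C d \<beta> by (intro mult_left_mono powr_mono2) auto
      then show ?thesis
        using D(2)[OF p'F[OF xy(1)] p'F[OF xy(2)]] C(2) by linarith
    qed
    ultimately show ?case
      using p'F by (intro exI[of _ p']) blast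
  qed
  show ?thesis
    unfolding has_hoelder_discretisations_def
  proof (intro exI[of _ C] allI impI)
    fix \<eta> :: real assume "\<eta> > 0"
    then obtain n where "r ^ n < \<eta> / D"
      using real_arch_pow_inv[of "\<eta> / D" r] D r by auto
    then have n: "r ^ n * D \<le> \<eta>"
      using D by (simp add: field_simps)
    obtain p where p: "p ` F \<subseteq> F" "finite (p ` F)" "\<And>x. x \<in> F \<Longrightarrow> dist x (p x) \<le> r ^ n * D"
      "\<forall>x\<in>F. \<forall>y\<in>F. dist (p x) (p y) \<le> C * dist x y powr \<beta>"
      using discretise[of n] by blast
    have "\<forall>x\<in>F. dist x (p x) \<le> \<eta>"
      using p(3) n by (meson order_trans)
    with p show "\<exists>p. p ` F \<subseteq> F \<and> finite (p ` F) \<and> (\<forall>x\<in>F. dist x (p x) \<le> \<eta>) \<and>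
        (\<forall>x\<in>F. \<forall>y\<in>F. dist (p x) (p y) \<le> C * dist x y powr \<beta>)"
      by (intro exI[of _ p] conjI)
  qed
qed

text \<open>
  Since \<open>\<nu> powr (ln \<rho> / ln \<nu>) = \<rho>\<close>, any exponent below this quotient works for the pair, and a
  finite family admits a common one.
\<close>

lemma exists_common_exponent:
  fixes \<rho> \<nu> :: "'i \<Rightarrow> real"
  assumes "finite I" and "\<And>i. i \<in> I \<Longrightarrow> 0 < \<rho> i \<and> \<rho> i < 1 \<and> 0 < \<nu> i \<and> \<nu> i < 1"
  shows "\<exists>\<beta>>0. \<beta> \<le> 1 \<and> (\<forall>i\<in>I. \<rho> i \<le> \<nu> i powr \<beta>)"
proof (intro exI conjI ballI)
  let ?b = "Min (insert 1 ((\<lambda>i. ln (\<rho> i) / ln (\<nu> i)) ` I))"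
  have fin: "finite (insert 1 ((\<lambda>i. ln (\<rho> i) / ln (\<nu> i)) ` I))"
    using assms(1) by simp
  have "0 < ln (\<rho> i) / ln (\<nu> i)" if "i \<in> I" for i
    using assms(2)[OF that] by (intro divide_neg_neg) (simp_all add: ln_less_zero)
  then show "0 < ?b"
    using fin by (subst Min_gr_iff) auto
  show "?b \<le> 1"
    using fin by (intro Min_le) auto
  fix i assume i: "i \<in> I"
  then have "?b \<le> ln (\<rho> i) / ln (\<nu> i)"
    using fin by (intro Min_le) auto
  then have "\<nu> i powr (ln (\<rho> i) / ln (\<nu> i)) \<le> \<nu> i powr ?b"
    using assms(2)[OF i] by (intro powr_mono') auto
  moreover have "\<nu> i powr (ln (\<rho> i) / ln (\<nu> i)) = \<rho> i"
    using assms(2)[OF i] by (simp add: powr_def)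
  ultimately show "\<rho> i \<le> \<nu> i powr ?b" by simp
qed

theorem corollary5p5:
  fixes F :: "(real ^ 'p) set"
    and X :: "(real ^ 'p) set"
    and m :: nat
    and f :: "nat \<Rightarrow> real ^ 'p \<Rightarrow> real ^ 'p"
  assumes "ifs X m f"
    and "attractor_of X m f F"
    and "strong_separation m f F"
  shows "(bi_lipschitz_ifs X m f \<longrightarrow>
            (\<exists>\<alpha>\<^sub>0>0. \<forall>\<alpha>. 0 < \<alpha> \<and> \<alpha> < \<alpha>\<^sub>0 \<longrightarrow> D_star_lower \<alpha> F = 0 \<and> D_star \<alpha> F = 0)) \<and>
         (similarity_ifs X m f \<longrightarrow>
            (\<forall>\<alpha>. 0 < \<alpha> \<and> \<alpha> < 1 \<longrightarrow> D_star_lower \<alpha> F = 0 \<and> D_star \<alpha> F = 0))"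
proof -
  have m: "1 \<le> m"
    using assms(1) by (simp add: ifs_def)
  have FX: "F \<subseteq> X" and F: "compact F" "F \<noteq> {}" "F = (\<Union>i\<in>{1..m}. f i ` F)"
    using assms(2) unfolding attractor_of_def by blast+
  have vanish: "D_star_lower \<alpha> F = 0 \<and> D_star \<alpha> F = 0"
    if \<beta>: "0 < \<beta>" "\<beta> \<le> 1" and \<alpha>: "0 < \<alpha>" "\<alpha> < \<beta>"
      and \<rho>\<nu>: "\<forall>i\<in>{1..m}. 0 < \<rho> i \<and> \<rho> i < 1 \<and> 0 < \<nu> i \<and> \<rho> i \<le> \<nu> i powr \<beta>"
      and bounds: "\<forall>i\<in>{1..m}. \<forall>x\<in>X. \<forall>y\<in>X. \<nu> i * dist x y \<le> dist (f i x) (f i y) \<and>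
        dist (f i x) (f i y) \<le> \<rho> i * dist x y"
    for \<alpha> \<beta> and \<rho> \<nu> :: "nat \<Rightarrow> real"
  proof -
    have "has_hoelder_discretisations \<beta> F"
    proof (rule attractor_has_hoelder_discretisations[OF m F assms(3) \<beta>(1)])
      fix i assume i: "i \<in> {1..m}"
      show "0 < \<rho> i \<and> \<rho> i < 1 \<and> 0 < \<nu> i \<and> \<rho> i \<le> \<nu> i powr \<beta>"
        using \<rho>\<nu> i by (rule bspec)
      fix x y assume "x \<in> F" "y \<in> F"
      then have "x \<in> X" "y \<in> X" using FX by blast+
      then show "dist (f i x) (f i y) \<le> \<rho> i * dist x y" "\<nu> i * dist x y \<le> dist (f i x) (f i y)"
        using bspec[OF bspec[OF bspec[OF bounds i]]] by simp_all
    qed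
    then show ?thesis
      using D_star_lower_eq_0[OF F(1,2) \<alpha> \<beta>(2)] D_star_eq_0[OF F(1,2) \<alpha> \<beta>(2)] by blast
  qed
  show ?thesis
  proof (intro conjI impI)
    assume "bi_lipschitz_ifs X m f"
    then obtain \<rho> \<nu> where \<rho>\<nu>: "\<forall>i\<in>{1..m}. 0 < \<rho> i \<and> \<rho> i < 1 \<and> 0 < \<nu> i \<and> \<nu> i < 1 \<and>
        (\<forall>x\<in>X. \<forall>y\<in>X. \<nu> i * dist x y \<le> dist (f i x) (f i y) \<and> dist (f i x) (f i y) \<le> \<rho> i * dist x y)"
      unfolding bi_lipschitz_ifs_def by metis
    then obtain \<beta> where \<beta>: "0 < \<beta>" "\<beta> \<le> 1" "\<forall>i\<in>{1..m}. \<rho> i \<le> \<nu> i powr \<beta>"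
      using exists_common_exponent[of "{1..m}" \<rho> \<nu>] by (metis finite_atLeastAtMost)
    show "\<exists>\<alpha>\<^sub>0>0. \<forall>\<alpha>. 0 < \<alpha> \<and> \<alpha> < \<alpha>\<^sub>0 \<longrightarrow> D_star_lower \<alpha> F = 0 \<and> D_star \<alpha> F = 0"
      using vanish[of \<beta> _ \<rho> \<nu>] \<beta> \<rho>\<nu> by (intro exI[of _ \<beta>]) simp
  next
    assume "similarity_ifs X m f"
    then obtain \<rho> where \<rho>: "\<forall>i\<in>{1..m}. 0 < \<rho> i \<and> \<rho> i < 1 \<and>
        (\<forall>x\<in>X. \<forall>y\<in>X. dist (f i x) (f i y) = \<rho> i * dist x y)"
      unfolding similarity_ifs_def by metis
    show "\<forall>\<alpha>. 0 < \<alpha> \<and> \<alpha> < 1 \<longrightarrow> D_star_lower \<alpha> F = 0 \<and> D_star \<alpha> F = 0"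
    proof (intro allI impI)
      fix \<alpha> :: real assume "0 < \<alpha> \<and> \<alpha> < 1"
      then show "D_star_lower \<alpha> F = 0 \<and> D_star \<alpha> F = 0"
        using \<rho> by (intro vanish[of 1 \<alpha> \<rho> \<rho>]) (simp_all add: abs_ge_self)
    qed
  qed
qed

end
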